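(* Let $A$ be an $n\times n$ complex EP matrix, $X$ an $n\times p$ complex matrix, $Y$ an $n\times q$ complex matrix, and let $$M = A^{\dagger} - A^{\dagger} X (Y^{*} A^{\dagger} X)^{\dagger} Y^{*} A^{\dagger}.$$ Let $\hat X,\hat Y$ be matrices with $\operatorname{im}(\hat X)=\ker(M)$ and $\operatorname{im}(\hat Y)=\operatorname{im}(M)^{\perp}$. Suppose $\operatorname{ind}(M)=1$, that $\hat X$ and $\hat Y$ have the same number of columns, and that $$\ker(P_{\mathcal A}\hat X)\cap\ker(P_{\mathcal A}\hat Y)^{\perp}=\{0\},$$ where $P_{\mathcal A}=AA^{\dagger}$ is the orthogonal projection matrix onto $\mathcal A=\operatorname{im}(A)$. Then $$|M|_{\dagger}=\frac{|\hat Y^{*}P_{\mathcal A}\hat X|_{\dagger}}{|A|_{\dagger}\,|\hat Y^{*}A^{\dagger}\hat X|_{\dagger}}.$$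
   Context: $(\cdot)^{\dagger}$ is the Moore-Penrose pseudo-inverse, $(\cdot)^{*}$ the conjugate transpose, $(\cdot)^{\perp}$ the orthogonal complement. $|\cdot|_{\dagger}$ denotes the pseudo-determinant of a square matrix: the product of its non-zero eigenvalues (with algebraic multiplicity), with value $1$ for a nilpotent matrix. A square matrix $A$ is EP (range-Hermitian) if $\operatorname{im}(A)=\operatorname{im}(A^{*})$. The index of a square matrix $M$ is $\operatorname{ind}(M)=\min\{k\ge 1 : \operatorname{rank}(M^{k+1})=\operatorname{rank}(M^{k})\}$. *)

theory Defs
  imports
    "Jordan_Normal_Form.Schur_Decomposition"
    "Jordan_Normal_Form.Spectral_Radius"
    "Jordan_Normal_Form.Matrix_Kernel"
    "Jordan_Normal_Form.DL_Rank"
begin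

text \<open>The four Penrose equations determine the pseudo-inverse uniquely, and over the
  complex numbers they are always solvable.\<close>

definition is_pinv :: "complex mat \<Rightarrow> complex mat \<Rightarrow> bool" where
  "is_pinv A B \<longleftrightarrow>
     B \<in> carrier_mat (dim_col A) (dim_row A) \<and>
     A * B * A = A \<and>
     B * A * B = B \<and>
     mat_adjoint (A * B) = A * B \<and>
     mat_adjoint (B * A) = B * A"

definition pinv :: "complex mat \<Rightarrow> complex mat" where
  "pinv A = (THE B. is_pinv A B)"

definition mat_im :: "complex mat \<Rightarrow> complex vec set" where
  "mat_im A = vec_space.col_space (dim_row A) A"

text \<open>Vectors carry their dimension as a value, so the ambient space of the complement
  has to be given explicitly.\<close>

definition orth_compl :: "nat \<Rightarrow> complex vec set \<Rightarrow> complex vec set" where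
  "orth_compl n W = {v \<in> carrier_vec n. \<forall>w \<in> W. v \<bullet>c w = 0}"

text \<open>Algebraic multiplicity is the order of the eigenvalue as a root of the characteristic
  polynomial. The empty product gives 1 for nilpotent and for 0-by-0 matrices.\<close>

definition pseudo_det :: "complex mat \<Rightarrow> complex" where
  "pseudo_det A = (\<Prod>k \<in> spectrum A - {0}. k ^ Polynomial.order k (char_poly A))"

definition EP_mat :: "complex mat \<Rightarrow> bool" where
  "EP_mat A \<longleftrightarrow> square_mat A \<and> mat_im A = mat_im (mat_adjoint A)"

definition mat_index :: "complex mat \<Rightarrow> nat" where
  "mat_index M = (LEAST k. k \<ge> 1 \<and>
     vec_space.rank (dim_row M) (M ^\<^sub>m (k + 1)) = vec_space.rank (dim_row M) (M ^\<^sub>m k))"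

end

theory Submission
  imports Defs "HOL-Computational_Algebra.Fundamental_Theorem_Algebra"
begin

text \<open>
  Compressing with an orthonormal basis U of the range of A turns A, its pseudo-inverse and M into
  square matrices C, B = 1/C and N; range-Hermitianness is what makes A equal to U C U*. The
  correction term of M compresses to B Q B with Q B Q = Q, and a rank factorization Q = G L then
  satisfies L B G = 1. So N = B - B G L B has kernel im G and range ker L, the compressed columns of
  the two given matrices are G S and (T L)*, and all three pseudo-determinants in which they or M
  occur become products of det B, det (L G) and det (S T), because the non-zero eigenvalues of a
  product do not depend on the order of the two factors. The index hypothesis says that L G is
  invertible, the kernel hypothesis that S T is.
\<close>

subsection \<open>Matrix algebra with dimension side conditions\<close>

text \<open>The obstacle is that pseudo-determinants are not multiplicative. Up to sign such a value
  is the lowest non-zero coefficient of the characteristic polynomial, and every product is rotated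
  until it is a square invertible matrix, where the value is an ordinary determinant. This matters
  because \<open>Xhat\<close> and \<open>Yhat\<close> may have linearly dependent columns:
  \<open>T * S\<close> is \<open>r\<close> by \<open>r\<close> and may be singular, whereas
  \<open>S * T\<close> has size \<open>k\<close>, the dimension of the kernel of \<open>N\<close>.
  Index 1 says that the range ker L and the kernel im G of \<open>N\<close> are complementary, which
  is invertibility of \<open>L * G\<close>; it also makes \<open>k\<close> the exact multiplicity of
  the eigenvalue 0 of \<open>N\<close>. With det C * det B = 1 the formula then reduces to
  cancelling det (S T).\<close>

lemma mat_mult_assoc_dims:
  fixes A B C :: "'a :: semiring_0 mat"
  assumes "dim_col A = dim_row B" "dim_col B = dim_row C"
  shows "A * B * C = A * (B * C)"
  by (rule assoc_mult_mat[of A "dim_row A" "dim_row B" B "dim_row C" C "dim_col C"])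
    (rule carrier_matI; simp add: assms)+

lemma mat_adjoint_dims [simp]:
  "dim_row (mat_adjoint A) = dim_col A" "dim_col (mat_adjoint A) = dim_row A"
  unfolding mat_adjoint_def by auto

lemma mat_adjoint_carrier [simp]: "A \<in> carrier_mat m n \<Longrightarrow> mat_adjoint A \<in> carrier_mat n m"
  by (rule carrier_matI) auto

lemma mat_adjoint_index:
  assumes "i < dim_col A" "j < dim_row A"
  shows "mat_adjoint A $$ (i, j) = conjugate (A $$ (j, i))"
  using assms unfolding mat_adjoint_def by (auto simp: mat_of_rows_index)

lemma mat_adjoint_adjoint [simp]: "mat_adjoint (mat_adjoint A) = A"
  by (rule eq_matI) (auto simp: mat_adjoint_index)

lemma mat_adjoint_one [simp]: "mat_adjoint (1\<^sub>m n :: complex mat) = 1\<^sub>m n"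
  by (rule eq_matI) (auto simp: mat_adjoint_index)

lemma mat_adjoint_mult:
  fixes A B :: "complex mat"
  assumes "dim_col A = dim_row B"
  shows "mat_adjoint (A * B) = mat_adjoint B * mat_adjoint A"
proof (rule eq_matI)
  fix i j assume ij: "i < dim_row (mat_adjoint B * mat_adjoint A)" "j < dim_col (mat_adjoint B * mat_adjoint A)"
  then have "mat_adjoint (A * B) $$ (i, j) = cnj (\<Sum>k<dim_row B. A $$ (j, k) * B $$ (k, i))"
    using assms by (simp add: mat_adjoint_index scalar_prod_def atLeast0LessThan)
  also have "\<dots> = (\<Sum>k<dim_row B. cnj (B $$ (k, i)) * cnj (A $$ (j, k)))"
    by (simp add: mult.commute)
  also have "\<dots> = (mat_adjoint B * mat_adjoint A) $$ (i, j)"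
    using assms ij by (simp add: mat_adjoint_index scalar_prod_def atLeast0LessThan)
  finally show "mat_adjoint (A * B) $$ (i, j) = (mat_adjoint B * mat_adjoint A) $$ (i, j)" .
qed simp_all

lemma mat_adjoint_scalar_prod:
  fixes A :: "complex mat"
  assumes "dim_vec v = dim_row A" "dim_vec w = dim_col A"
  shows "(mat_adjoint A *\<^sub>v v) \<bullet>c w = v \<bullet>c (A *\<^sub>v w)"
proof -
  have "(mat_adjoint A *\<^sub>v v) \<bullet>c w
      = (\<Sum>i<dim_col A. \<Sum>j<dim_row A. cnj (A $$ (j, i)) * v $ j * cnj (w $ i))"
    using assms by (auto simp: scalar_prod_def mat_adjoint_index sum_distrib_right atLeast0LessThan
        intro!: sum.cong)
  also have "\<dots> = (\<Sum>j<dim_row A. \<Sum>i<dim_col A. cnj (A $$ (j, i)) * v $ j * cnj (w $ i))"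
    by (rule sum.swap)
  also have "\<dots> = v \<bullet>c (A *\<^sub>v w)"
    using assms by (auto simp: scalar_prod_def sum_distrib_left atLeast0LessThan mult_ac
        intro!: sum.cong)
  finally show ?thesis .
qed

lemma mat_minus_mult_dims:
  fixes A B C :: "'a :: ring mat"
  assumes "dim_row A = dim_row B" "dim_col A = dim_col B" "dim_col B = dim_row C"
  shows "(A - B) * C = A * C - B * C"
  by (rule minus_mult_distrib_mat[of A "dim_row B" "dim_row C" B C "dim_col C"])
    (rule carrier_matI; simp add: assms)+

lemma mat_mult_minus_dims:
  fixes A B C :: "'a :: ring mat"
  assumes "dim_row B = dim_row C" "dim_col B = dim_col C" "dim_col A = dim_row C"
  shows "A * (B - C) = A * B - A * C"
  by (rule mult_minus_distrib_mat[of A "dim_row A" "dim_row C" B "dim_col C" C])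
    (rule carrier_matI; simp add: assms)+

lemma mat_add_mult_dims:
  fixes A B C :: "'a :: ring mat"
  assumes "dim_row A = dim_row B" "dim_col A = dim_col B" "dim_col B = dim_row C"
  shows "(A + B) * C = A * C + B * C"
  by (rule add_mult_distrib_mat[of A "dim_row B" "dim_row C" B C "dim_col C"])
    (rule carrier_matI; simp add: assms)+

lemma mat_smult_mult_dims:
  fixes A B :: "'a :: comm_semiring_1 mat"
  assumes "dim_col A = dim_row B"
  shows "(c \<cdot>\<^sub>m A) * B = c \<cdot>\<^sub>m (A * B)" "A * (c \<cdot>\<^sub>m B) = c \<cdot>\<^sub>m (A * B)"
  by (rule mult_smult_assoc_mat[of A "dim_row A" "dim_row B" B "dim_col B"],
      (rule carrier_matI; simp add: assms)+)
    (rule mult_smult_distrib[of A "dim_row A" "dim_row B" B "dim_col B"],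
      (rule carrier_matI; simp add: assms)+)

lemmas mat_dims_simps = mat_minus_mult_dims mat_mult_minus_dims mat_add_mult_dims
  mat_smult_mult_dims

text \<open>Products are normalized by associating to the right, so an equation A B = 1 is only met
  in the shape A (B Z); this is its form as a rewrite rule. Side conditions are equations between
  dimensions, which the simplifier can discharge without guessing intermediate sizes.\<close>

lemma left_inverse_mult_cancel:
  fixes A B Z :: "'a :: semiring_1 mat"
  assumes "A * B = 1\<^sub>m k" "dim_col A = dim_row B" "dim_col B = dim_row Z" "dim_row Z = k"
  shows "A * (B * Z) = Z"
  using assms mat_mult_assoc_dims[of A B Z] by simp

lemma mat_minus_self: "A - A = (0\<^sub>m (dim_row A) (dim_col A) :: 'a :: group_add mat)"
  by (rule eq_matI) auto

lemma mat_mult_zero_vec [simp]: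
  fixes A :: "'a :: semiring_0 mat"
  shows "dim_col A = n \<Longrightarrow> A *\<^sub>v 0\<^sub>v n = 0\<^sub>v (dim_row A)"
  by (rule eq_vecI) auto

lemma mat_eq_if_minus_eq_0:
  fixes A B :: "'a :: group_add mat"
  assumes "0\<^sub>m m n = A - B" "dim_row A = m" "dim_col A = n" "dim_row B = m" "dim_col B = n"
  shows "A = B"
proof (rule eq_matI)
  fix i j assume "i < dim_row B" "j < dim_col B"
  then show "A $$ (i, j) = B $$ (i, j)"
    using arg_cong[OF assms(1), of "\<lambda>Z. Z $$ (i, j)"] assms(2-) by simp
qed (use assms in simp_all)

lemma mat_minus_eq_uminus_swap:
  fixes A B D :: "'a :: ab_group_add mat"
  assumes eq: "A - B = 0\<^sub>m m n - D"
    and dims: "dim_row A = m" "dim_col A = n" "dim_row B = m" "dim_col B = n" "dim_row D = m" "dim_col D = n"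
  shows "B - D = A"
proof (rule eq_matI)
  fix i j assume ij: "i < dim_row A" "j < dim_col A"
  then have "A $$ (i, j) - B $$ (i, j) = - D $$ (i, j)"
    using arg_cong[OF eq, of "\<lambda>Z. Z $$ (i, j)"] dims by simp
  then show "(B - D) $$ (i, j) = A $$ (i, j)" using ij dims by (simp add: algebra_simps)
qed (use dims in simp_all)

lemma mat_adjoint_zero [simp]: "mat_adjoint (0\<^sub>m m n :: complex mat) = 0\<^sub>m n m"
  by (rule eq_matI) (auto simp: mat_adjoint_index)

subsection \<open>Pseudo-determinants\<close>

lemma char_poly_factor_zero:
  fixes A :: "complex mat"
  assumes A: "A \<in> carrier_mat n n"
  obtains j p where "char_poly A = [:0, 1:] ^ j * p" "poly p 0 \<noteq> 0"
proof -
  have "char_poly A \<noteq> 0" using degree_monic_char_poly[OF A] by auto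
  from order_decomp[OF this, of 0] obtain p
    where "char_poly A = [:- 0, 1:] ^ Polynomial.order 0 (char_poly A) * p" "\<not> [:- 0, 1:] dvd p"
    by blast
  then show ?thesis
    using that[of "Polynomial.order 0 (char_poly A)" p] by (simp add: poly_eq_0_iff_dvd)
qed

text \<open>Once the root 0 is split off, \<open>p\<close> is the product of the factors x - z over
  the non-zero eigenvalues with multiplicity, so its value at 0 is the product of the numbers -z.
  There are n - j of them, which gives the sign. From here on pseudo-determinants follow from
  polynomial identities alone.\<close>

lemma pseudo_det_char_poly:
  assumes A: "A \<in> carrier_mat n n"
    and p: "char_poly A = [:0, 1:] ^ j * p" "poly p 0 \<noteq> 0"
  shows "j \<le> n" "pseudo_det A = (-1) ^ (n - j) * poly p 0"
proof -
  let ?c = "char_poly A"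
  define R where "R = {z. poly ?c z = 0} - {0}"
  let ?o = "\<lambda>z. Polynomial.order z ?c"
  have nz: "?c \<noteq> 0" and deg: "degree ?c = n" and lc: "lead_coeff ?c = 1"
    using degree_monic_char_poly[OF A] by auto
  have fin: "finite {z. poly ?c z = 0}" using nz poly_roots_finite by blast
  then have finR: "finite R" by (simp add: R_def)
  have o0: "?o 0 = j"
  proof -
    have "p \<noteq> 0" using p(2) by auto
    then have "?o 0 = Polynomial.order 0 ([:0,1:]^j :: complex poly) + Polynomial.order 0 p"
      unfolding p(1) using Polynomial.order_mult[of "[:0,1:]^j" p 0] by auto
    then show ?thesis using p(2) order_power_n_n[of 0 j] by (simp add: order_root order_0I)
  qed
  define g where "g = (\<Prod>z\<in>R. [:-z, 1:] ^ ?o z)"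
  have "?c = (\<Prod>z | poly ?c z = 0. [:-z, 1:] ^ ?o z)"
    using complex_poly_decompose[of ?c] lc by simp
  \<comment> \<open>If 0 is not an eigenvalue, the factor added for it has exponent 0, so
    \<open>j = 0\<close> and \<open>j > 0\<close> are treated alike.\<close>
  also have "\<dots> = (\<Prod>z\<in>insert 0 R. [:-z, 1:] ^ ?o z)"
  proof (rule prod.mono_neutral_left)
    show "\<forall>z\<in>insert 0 R - {z. poly ?c z = 0}. [:-z, 1:] ^ ?o z = 1"
      using order_0I by (fastforce simp: R_def)
  qed (use finR in \<open>auto simp: R_def\<close>)
  also have "\<dots> = [:0, 1:] ^ j * g"
    using finR o0 by (subst prod.insert) (auto simp: R_def g_def)
  finally have cg: "?c = [:0, 1:] ^ j * g" .
  then have "g = p" using p(1) by simp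
  have "degree g = (\<Sum>z\<in>R. ?o z)"
    unfolding g_def by (subst degree_prod_eq_sum_degree) (auto simp: degree_power_eq)
  moreover have "n = j + degree g"
    using cg deg nz degree_mult_eq[of "[:0, 1:] ^ j" g] by (auto simp: degree_power_eq)
  ultimately have sum: "(\<Sum>z\<in>R. ?o z) = n - j" and "j \<le> n" by auto
  show "j \<le> n" by fact
  have "poly p 0 = (\<Prod>z\<in>R. (-1) ^ ?o z * z ^ ?o z)"
    unfolding \<open>g = p\<close>[symmetric] g_def poly_prod
    by (intro prod.cong refl) (simp, rule power_minus)
  also have "\<dots> = (-1) ^ (n - j) * (\<Prod>z\<in>R. z ^ ?o z)"
    by (simp add: prod.distrib sum[symmetric] power_sum)
  also have "(\<Prod>z\<in>R. z ^ ?o z) = pseudo_det A"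
    unfolding pseudo_det_def spectrum_root_char_poly[OF A] R_def ..
  finally show "pseudo_det A = (-1) ^ (n - j) * poly p 0" by simp
qed

lemma poly_char_poly_0:
  assumes A: "(A :: 'a :: field mat) \<in> carrier_mat n n"
  shows "poly (char_poly A) 0 = (-1) ^ n * det A"
proof -
  have "poly (char_poly A) 0 = det (- A)"
    unfolding char_poly_matrix[OF A] using A
    by (intro arg_cong[of _ _ det] eq_matI) (auto simp: char_matrix_def)
  also have "- A = (-1) \<cdot>\<^sub>m A" by auto
  finally show ?thesis using A by simp
qed

lemma pseudo_det_eq_det:
  assumes A: "A \<in> carrier_mat n n" and "det A \<noteq> 0"
  shows "pseudo_det A = det A"
  using pseudo_det_char_poly(2)[OF A, of 0 "char_poly A"] assms(2)
  by (simp add: poly_char_poly_0[OF A])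

section \<open>Exchanging the factors of a product, by block determinants\<close>

lemma det_four_block_unitriangular:
  fixes C :: "'a :: idom mat"
  assumes "C \<in> carrier_mat k m"
  shows "det (four_block_mat (1\<^sub>m m) (0\<^sub>m m k) C (1\<^sub>m k)) = 1"
  using det_four_block_mat_upper_right_zero[of "1\<^sub>m m" m "0\<^sub>m m k" k C "1\<^sub>m k"] assms by simp

text \<open>Sylvester's identity. The same unitriangular \<open>F\<close> clears the lower left
  block of \<open>E\<close> from either side: \<open>E * F\<close> keeps x - A B on the diagonal,
  \<open>F * E\<close> keeps x - B A, and both products have determinant det E. Stated over a
  domain, without dividing by x, because x will be the indeterminate of a polynomial ring.\<close>

lemma det_smult_one_minus_mult_swap:
  fixes A B :: "'a :: idom mat"
  assumes A: "A \<in> carrier_mat m n" and B: "B \<in> carrier_mat n m"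
  shows "x ^ n * det (x \<cdot>\<^sub>m 1\<^sub>m m - A * B) = x ^ m * det (x \<cdot>\<^sub>m 1\<^sub>m n - B * A)"
proof -
  define E where "E = four_block_mat (x \<cdot>\<^sub>m 1\<^sub>m m) A (x \<cdot>\<^sub>m B) (x \<cdot>\<^sub>m 1\<^sub>m n)"
  define F where "F = four_block_mat (1\<^sub>m m) (0\<^sub>m m n) (-B) (1\<^sub>m n)"
  have [simp]: "dim_row A = m" "dim_col A = n" "dim_row B = n" "dim_col B = m" using A B by auto
  have carr: "E \<in> carrier_mat (m + n) (m + n)" "F \<in> carrier_mat (m + n) (m + n)"
    by (rule carrier_matI; simp add: E_def F_def)+
  have carr1: "x \<cdot>\<^sub>m 1\<^sub>m m - A * B \<in> carrier_mat m m" and carr2: "x \<cdot>\<^sub>m 1\<^sub>m n - B * A \<in> carrier_mat n n"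
    by (rule carrier_matI; simp)+
  have "det F = 1" unfolding F_def by (rule det_four_block_unitriangular) (rule carrier_matI; simp)
  have "E * F = four_block_mat (x \<cdot>\<^sub>m 1\<^sub>m m * 1\<^sub>m m + A * (-B)) (x \<cdot>\<^sub>m 1\<^sub>m m * 0\<^sub>m m n + A * 1\<^sub>m n)
      (x \<cdot>\<^sub>m B * 1\<^sub>m m + x \<cdot>\<^sub>m 1\<^sub>m n * (-B)) (x \<cdot>\<^sub>m B * 0\<^sub>m m n + x \<cdot>\<^sub>m 1\<^sub>m n * 1\<^sub>m n)"
    unfolding E_def F_def by (rule mult_four_block_mat[of _ m m _ n _ n _ _ m _ n]) (rule carrier_matI; simp)+
  also have "\<dots> = four_block_mat (x \<cdot>\<^sub>m 1\<^sub>m m - A * B) A (0\<^sub>m n m) (x \<cdot>\<^sub>m 1\<^sub>m n)"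
    by (intro arg_cong4[where f = four_block_mat])
      (auto simp: mat_dims_simps intro!: eq_matI)
  finally have "det (E * F) = det (x \<cdot>\<^sub>m 1\<^sub>m m - A * B) * det (x \<cdot>\<^sub>m 1\<^sub>m n :: 'a mat)"
    using det_four_block_mat_lower_left_zero[of "x \<cdot>\<^sub>m 1\<^sub>m m - A * B" m A n "0\<^sub>m n m" "x \<cdot>\<^sub>m 1\<^sub>m n"] carr1 A by simp
  then have 1: "det E = det (x \<cdot>\<^sub>m 1\<^sub>m m - A * B) * x ^ n"
    using det_mult[OF carr] \<open>det F = 1\<close> by simp
  have "F * E = four_block_mat (1\<^sub>m m * (x \<cdot>\<^sub>m 1\<^sub>m m) + 0\<^sub>m m n * (x \<cdot>\<^sub>m B)) (1\<^sub>m m * A + 0\<^sub>m m n * (x \<cdot>\<^sub>m 1\<^sub>m n))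
      (-B * (x \<cdot>\<^sub>m 1\<^sub>m m) + 1\<^sub>m n * (x \<cdot>\<^sub>m B)) (-B * A + 1\<^sub>m n * (x \<cdot>\<^sub>m 1\<^sub>m n))"
    unfolding E_def F_def by (rule mult_four_block_mat[of _ m m _ n _ n _ _ m _ n]) (rule carrier_matI; simp)+
  also have "\<dots> = four_block_mat (x \<cdot>\<^sub>m 1\<^sub>m m) A (0\<^sub>m n m) (x \<cdot>\<^sub>m 1\<^sub>m n - B * A)"
    by (intro arg_cong4[where f = four_block_mat])
      (auto simp: mat_dims_simps intro!: eq_matI)
  finally have "det (F * E) = det (x \<cdot>\<^sub>m 1\<^sub>m m :: 'a mat) * det (x \<cdot>\<^sub>m 1\<^sub>m n - B * A)"
    using det_four_block_mat_lower_left_zero[of "x \<cdot>\<^sub>m 1\<^sub>m m" m A n "0\<^sub>m n m" "x \<cdot>\<^sub>m 1\<^sub>m n - B * A"] carr2 A by simp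
  then have 2: "det E = x ^ m * det (x \<cdot>\<^sub>m 1\<^sub>m n - B * A)"
    using det_mult[OF carr(2,1)] \<open>det F = 1\<close> by simp
  from 1 2 show ?thesis by (simp add: mult.commute)
qed

text \<open>Embedding scalars as constant polynomials carries matrix identities over to polynomial
  matrices, where the characteristic matrix x - A is an honest difference and the block identities
  apply with x the indeterminate.\<close>

interpretation const_poly_hom: comm_ring_hom "\<lambda>a :: 'a :: comm_ring_1. [:a:]"
  by unfold_locales auto

lemma char_poly_eq_det:
  assumes "A \<in> carrier_mat n n"
  shows "char_poly A = det ([:0, 1:] \<cdot>\<^sub>m 1\<^sub>m n - map_mat (\<lambda>a. [:a:]) A)"
  unfolding char_poly_def char_poly_matrix_def using assms
  by (intro arg_cong[of _ _ det] eq_matI) auto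

lemma char_poly_mult_swap:
  fixes A B :: "'a :: idom mat"
  assumes A: "A \<in> carrier_mat m n" and B: "B \<in> carrier_mat n m"
  shows "[:0, 1:] ^ n * char_poly (A * B) = [:0, 1:] ^ m * char_poly (B * A)"
  using det_smult_one_minus_mult_swap[of "map_mat (\<lambda>a. [:a:]) A" m n "map_mat (\<lambda>a. [:a:]) B" "[:0, 1:]"]
    A B
  by (simp add: char_poly_eq_det[of "A * B" m] char_poly_eq_det[of "B * A" n]
      const_poly_hom.mat_hom_mult)

lemma order_0_power_mult:
  fixes r :: "'a :: field poly"
  assumes "poly r 0 \<noteq> 0"
  shows "Polynomial.order 0 ([:0, 1:] ^ k * r) = k"
proof -
  have "r \<noteq> 0" using assms by auto
  then show ?thesis
    using Polynomial.order_mult[of "[:0, 1:] ^ k" r 0] order_power_n_n[of 0 k] assms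
    by (simp add: order_0I)
qed

text \<open>For A B = 1 the left side of the swap identity is x^n times a polynomial that does not
  vanish at 0, while x^m divides the right side. Comparing multiplicities of the root 0 gives the
  bound, which later compares ranks.\<close>

lemma one_sided_inverse_dims_le:
  fixes A B :: "'a :: field mat"
  assumes A: "A \<in> carrier_mat m n" and B: "B \<in> carrier_mat n m" and AB: "A * B = 1\<^sub>m m"
  shows "m \<le> n"
proof -
  have nz: "poly (char_poly (1\<^sub>m m :: 'a mat)) 0 \<noteq> 0" by (simp add: poly_char_poly_0[of _ m])
  have "[:0, 1:] ^ m dvd [:0, 1:] ^ n * char_poly (1\<^sub>m m :: 'a mat)"
    using char_poly_mult_swap[OF A B] AB by simp
  then have "m \<le> Polynomial.order 0 ([:0, 1:] ^ n * char_poly (1\<^sub>m m :: 'a mat))"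
    using nz order_divides[of 0 m "[:0, 1:] ^ n * char_poly (1\<^sub>m m :: 'a mat)"] by auto
  then show ?thesis using order_0_power_mult[OF nz] by simp
qed

text \<open>The two characteristic polynomials differ only by a power of x, so their cofactors
  without the root 0 coincide. The signs agree as well, since m - i and n - j both count the
  non-zero eigenvalues.\<close>

lemma pseudo_det_mult_swap:
  assumes A: "A \<in> carrier_mat m n" and B: "B \<in> carrier_mat n m"
  shows "pseudo_det (A * B) = pseudo_det (B * A)"
proof -
  have AB: "A * B \<in> carrier_mat m m" and BA: "B * A \<in> carrier_mat n n" using A B by auto
  obtain i p where p: "char_poly (A * B) = [:0, 1:] ^ i * p" "poly p 0 \<noteq> 0"
    by (rule char_poly_factor_zero[OF AB])
  obtain j q where q: "char_poly (B * A) = [:0, 1:] ^ j * q" "poly q 0 \<noteq> 0"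
    by (rule char_poly_factor_zero[OF BA])
  have eq: "[:0, 1:] ^ (n + i) * p = [:0, 1:] ^ (m + j) * q"
    using char_poly_mult_swap[OF A B] p q by (simp add: power_add mult_ac)
  have nm: "n + i = m + j" using order_0_power_mult[OF p(2), of "n + i"] order_0_power_mult[OF q(2), of "m + j"] eq by simp
  then have "p = q" using eq by simp
  moreover have "m - i = n - j"
    using nm pseudo_det_char_poly(1)[OF AB p] pseudo_det_char_poly(1)[OF BA q] by simp
  ultimately show ?thesis
    using pseudo_det_char_poly(2)[OF AB p] pseudo_det_char_poly(2)[OF BA q] by simp
qed

text \<open>
  Exhibits the factor \<open>x ^ k\<close> of the characteristic polynomial explicitly: both sides are obtained
  from the block matrix with rows (x - B, B G) and (-L B, 1) by column operations.
\<close>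

lemma det_smult_one_minus_oblique_complement:
  fixes B G L :: "'a :: idom mat"
  assumes B: "B \<in> carrier_mat n n" and G: "G \<in> carrier_mat n k" and L: "L \<in> carrier_mat k n"
    and LBG: "L * B * G = 1\<^sub>m k"
  shows "det (x \<cdot>\<^sub>m 1\<^sub>m n - (B - B * G * L * B))
    = x ^ k * det (four_block_mat (x \<cdot>\<^sub>m 1\<^sub>m n - B) G (-(L * B)) (0\<^sub>m k k))"
proof -
  have [simp]: "dim_row B = n" "dim_col B = n" "dim_row G = n" "dim_col G = k"
    "dim_row L = k" "dim_col L = n" using assms by auto
  have LBG': "L * (B * G) = 1\<^sub>m k" using LBG by (simp add: mat_mult_assoc_dims)
  define W where "W = four_block_mat (x \<cdot>\<^sub>m 1\<^sub>m n - B) (B * G) (-(L * B)) (1\<^sub>m k)"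
  define W' where "W' = four_block_mat (x \<cdot>\<^sub>m 1\<^sub>m n - B) G (-(L * B)) (0\<^sub>m k k)"
  define F where "F = four_block_mat (1\<^sub>m n) (0\<^sub>m n k) (L * B) (1\<^sub>m k)"
  define H where "H = four_block_mat (1\<^sub>m n) G (0\<^sub>m k n) (1\<^sub>m k)"
  define D where "D = four_block_mat (1\<^sub>m n) (0\<^sub>m n k) (0\<^sub>m k n) (x \<cdot>\<^sub>m 1\<^sub>m k)"
  have carr: "W \<in> carrier_mat (n + k) (n + k)" "W' \<in> carrier_mat (n + k) (n + k)"
    "F \<in> carrier_mat (n + k) (n + k)" "H \<in> carrier_mat (n + k) (n + k)"
    "D \<in> carrier_mat (n + k) (n + k)"
    by (rule carrier_matI; simp add: W_def W'_def F_def H_def D_def)+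
  have carr1: "x \<cdot>\<^sub>m 1\<^sub>m n - (B - B * G * L * B) \<in> carrier_mat n n" "B * G \<in> carrier_mat n k"
    by (rule carrier_matI; simp)+
  have "det F = 1" unfolding F_def by (rule det_four_block_unitriangular) (rule carrier_matI; simp)
  have "det H = 1" unfolding H_def
    using det_four_block_mat_lower_left_zero[of "1\<^sub>m n" n G k "0\<^sub>m k n" "1\<^sub>m k"] G by simp
  have "det D = x ^ k" unfolding D_def
    using det_four_block_mat_lower_left_zero[of "1\<^sub>m n" n "0\<^sub>m n k" k "0\<^sub>m k n" "x \<cdot>\<^sub>m 1\<^sub>m k"] by simp
  have "W * F = four_block_mat ((x \<cdot>\<^sub>m 1\<^sub>m n - B) * 1\<^sub>m n + B * G * (L * B)) ((x \<cdot>\<^sub>m 1\<^sub>m n - B) * 0\<^sub>m n k + B * G * 1\<^sub>m k)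
      (-(L * B) * 1\<^sub>m n + 1\<^sub>m k * (L * B)) (-(L * B) * 0\<^sub>m n k + 1\<^sub>m k * 1\<^sub>m k)"
    unfolding W_def F_def by (rule mult_four_block_mat[of _ n n _ k _ k _ _ n _ k]) (rule carrier_matI; simp)+
  also have "\<dots> = four_block_mat (x \<cdot>\<^sub>m 1\<^sub>m n - (B - B * G * L * B)) (B * G) (0\<^sub>m k n) (1\<^sub>m k)"
    by (intro arg_cong4[where f = four_block_mat])
      (auto simp: mat_dims_simps mat_mult_assoc_dims intro!: eq_matI)
  finally have "det (W * F) = det (x \<cdot>\<^sub>m 1\<^sub>m n - (B - B * G * L * B)) * det (1\<^sub>m k :: 'a mat)"
    using det_four_block_mat_lower_left_zero[of "x \<cdot>\<^sub>m 1\<^sub>m n - (B - B * G * L * B)" n "B * G" k "0\<^sub>m k n" "1\<^sub>m k"] carr1 by simp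
  then have 1: "det W = det (x \<cdot>\<^sub>m 1\<^sub>m n - (B - B * G * L * B))"
    using det_mult[OF carr(1,3)] \<open>det F = 1\<close> by simp
  have "W * H = four_block_mat ((x \<cdot>\<^sub>m 1\<^sub>m n - B) * 1\<^sub>m n + B * G * 0\<^sub>m k n) ((x \<cdot>\<^sub>m 1\<^sub>m n - B) * G + B * G * 1\<^sub>m k)
      (-(L * B) * 1\<^sub>m n + 1\<^sub>m k * 0\<^sub>m k n) (-(L * B) * G + 1\<^sub>m k * 1\<^sub>m k)"
    unfolding W_def H_def by (rule mult_four_block_mat[of _ n n _ k _ k _ _ n _ k]) (rule carrier_matI; simp)+
  \<comment> \<open>The hypothesis L B G = 1 cancels the corner block 1, so that all of the last
    \<open>k\<close> columns become divisible by \<open>x\<close>; \<open>D\<close> takes this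
    factor out.\<close>
  also have "\<dots> = four_block_mat (x \<cdot>\<^sub>m 1\<^sub>m n - B) (x \<cdot>\<^sub>m G) (-(L * B)) (0\<^sub>m k k)"
    by (intro arg_cong4[where f = four_block_mat])
      (auto simp: mat_dims_simps mat_mult_assoc_dims LBG' intro!: eq_matI)
  finally have WH: "W * H = four_block_mat (x \<cdot>\<^sub>m 1\<^sub>m n - B) (x \<cdot>\<^sub>m G) (-(L * B)) (0\<^sub>m k k)" .
  have "W' * D = four_block_mat ((x \<cdot>\<^sub>m 1\<^sub>m n - B) * 1\<^sub>m n + G * 0\<^sub>m k n) ((x \<cdot>\<^sub>m 1\<^sub>m n - B) * 0\<^sub>m n k + G * (x \<cdot>\<^sub>m 1\<^sub>m k))
      (-(L * B) * 1\<^sub>m n + 0\<^sub>m k k * 0\<^sub>m k n) (-(L * B) * 0\<^sub>m n k + 0\<^sub>m k k * (x \<cdot>\<^sub>m 1\<^sub>m k))"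
    unfolding W'_def D_def by (rule mult_four_block_mat[of _ n n _ k _ k _ _ n _ k]) (rule carrier_matI; simp)+
  also have "\<dots> = four_block_mat (x \<cdot>\<^sub>m 1\<^sub>m n - B) (x \<cdot>\<^sub>m G) (-(L * B)) (0\<^sub>m k k)"
    by (intro arg_cong4[where f = four_block_mat])
      (auto simp: mat_dims_simps mat_mult_assoc_dims intro!: eq_matI)
  finally have "W * H = W' * D" using WH by simp
  then have "det W = det W' * x ^ k"
    using det_mult[OF carr(1,4)] det_mult[OF carr(2,5)] \<open>det H = 1\<close> \<open>det D = x ^ k\<close> by simp
  with 1 show ?thesis by (simp add: W'_def mult.commute)
qed

text \<open>The characteristic polynomial is x^k times det V, and det V at 0 is, up to sign, det B *
  det (L G), hence non-zero: the eigenvalue 0 has multiplicity exactly k. The signs (-1)^(n-k) and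
  (-1)^(n+k) cancel.\<close>

lemma pseudo_det_oblique_complement:
  fixes B G L :: "complex mat"
  assumes B: "B \<in> carrier_mat n n" and G: "G \<in> carrier_mat n k" and L: "L \<in> carrier_mat k n"
    and LBG: "L * B * G = 1\<^sub>m k" and "det B \<noteq> 0" and "det (L * G) \<noteq> 0"
  shows "pseudo_det (B - B * G * L * B) = det B * det (L * G)"
proof -
  have [simp]: "dim_row B = n" "dim_col B = n" "dim_row G = n" "dim_col G = k"
    "dim_row L = k" "dim_col L = n" using assms by auto
  let ?h = "map_mat (\<lambda>a. [:a:]) :: complex mat \<Rightarrow> complex poly mat"
  define V where "V = four_block_mat ([:0, 1:] \<cdot>\<^sub>m 1\<^sub>m n - ?h B) (?h G) (-(?h L * ?h B)) (0\<^sub>m k k)"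
  have V: "V \<in> carrier_mat (n + k) (n + k)" by (rule carrier_matI; simp add: V_def)+
  have M: "B - B * G * L * B \<in> carrier_mat n n" by (rule carrier_matI; simp)
  have hM: "?h (B - B * G * L * B) = ?h B - ?h B * ?h G * ?h L * ?h B"
  proof -
    have "?h (B - B * G * L * B) = ?h B - ?h (B * G * L * B)" by (rule eq_matI) auto
    then show ?thesis
      using const_poly_hom.mat_hom_mult[of "B * G * L" n n B n] const_poly_hom.mat_hom_mult[of "B * G" n k L n]
        const_poly_hom.mat_hom_mult[of B n n G k] B G L by simp
  qed
  have "?h L * ?h B * ?h G = 1\<^sub>m k"
    using const_poly_hom.mat_hom_mult[of "L * B" k n G k] const_poly_hom.mat_hom_mult[of L k n B n]
      B G L LBG const_poly_hom.mat_hom_one[of k, where 'a = complex] by simp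
  then have cp: "char_poly (B - B * G * L * B) = [:0, 1:] ^ k * det V"
    unfolding char_poly_eq_det[OF M] hM V_def
    using B G L by (intro det_smult_one_minus_oblique_complement) simp_all
  \<comment> \<open>The value of \<open>V\<close> at x = 0. Multiplication by \<open>F\<close> adds
    -L times the first block row to the second, which clears -L B and leaves -L G in the
    corner.\<close>
  define V0 where "V0 = four_block_mat (-B) G (-(L * B)) (0\<^sub>m k k)"
  define F where "F = four_block_mat (1\<^sub>m n) (0\<^sub>m n k) (-L) (1\<^sub>m k)"
  have carr: "V0 \<in> carrier_mat (n + k) (n + k)" "F \<in> carrier_mat (n + k) (n + k)"
    by (rule carrier_matI; simp add: V0_def F_def)+
  have "map_mat (\<lambda>p. poly p 0) V = V0"
  proof -
    have "?h L * ?h B = ?h (L * B)" using const_poly_hom.mat_hom_mult[of L k n B n] B L by simp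
    then show ?thesis unfolding V_def V0_def by (intro eq_matI) auto
  qed
  moreover have "comm_ring_hom (\<lambda>p :: complex poly. poly p 0)" by unfold_locales auto
  ultimately have pV: "poly (det V) 0 = det V0" using comm_ring_hom.hom_det[of "\<lambda>p. poly p 0" V] by simp
  have carr1: "-B \<in> carrier_mat n n" "-(L * G) \<in> carrier_mat k k"
    by (rule carrier_matI; simp)+
  have "det F = 1" unfolding F_def by (rule det_four_block_unitriangular) (rule carrier_matI; simp)
  have "F * V0 = four_block_mat (1\<^sub>m n * (-B) + 0\<^sub>m n k * (-(L * B))) (1\<^sub>m n * G + 0\<^sub>m n k * 0\<^sub>m k k)
     (-L * (-B) + 1\<^sub>m k * (-(L * B))) (-L * G + 1\<^sub>m k * 0\<^sub>m k k)"
    unfolding F_def V0_def by (rule mult_four_block_mat[of _ n n _ k _ k _ _ n _ k]) (rule carrier_matI; simp)+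
  also have "\<dots> = four_block_mat (-B) G (0\<^sub>m k n) (-(L * G))"
    by (intro arg_cong4[where f = four_block_mat]) (auto intro!: eq_matI)
  finally have "det (F * V0) = det (-B) * det (-(L * G))"
    using det_four_block_mat_lower_left_zero[of "-B" n G k "0\<^sub>m k n" "-(L * G)"] carr1 G by simp
  also have "-B = (-1) \<cdot>\<^sub>m B" by auto
  also have "-(L * G) = (-1) \<cdot>\<^sub>m (L * G)" by auto
  finally have V0: "det V0 = (-1) ^ (n + k) * (det B * det (L * G))"
    using det_mult[OF carr(2,1)] \<open>det F = 1\<close> by (simp add: power_add)
  then have nz: "poly (det V) 0 \<noteq> 0" using assms pV by simp
  have "k \<le> n" by (rule pseudo_det_char_poly(1)[OF M cp nz])
  then have "(-1) ^ (n - k) * (-1) ^ (n + k) = (1 :: complex)"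
    by (simp add: power_add[symmetric])
  then show ?thesis
    using pseudo_det_char_poly(2)[OF M cp nz] pV V0 by (simp add: mult.assoc[symmetric])
qed

subsection \<open>Rank factorizations and pseudo-inverses\<close>

text \<open>A B = (A C)(A B) is a product of self-adjoint matrices; taking adjoints reverses the
  factors and turns it into A C. Likewise B A = C A, and then B = B A B = B A C = C A C = C.\<close>

lemma is_pinv_unique:
  assumes "is_pinv A B" "is_pinv A C"
  shows "B = C"
proof -
  define m n where "m = dim_row A" and "n = dim_col A"
  have [simp]: "dim_row A = m" "dim_col A = n" "dim_row B = n" "dim_col B = m"
    "dim_row C = n" "dim_col C = m"
    using assms by (auto simp: is_pinv_def m_def n_def)
  have B: "A * B * A = A" "B * A * B = B" "mat_adjoint (A * B) = A * B" "mat_adjoint (B * A) = B * A"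
    and C: "A * C * A = A" "C * A * C = C" "mat_adjoint (A * C) = A * C" "mat_adjoint (C * A) = C * A"
    using assms by (auto simp: is_pinv_def)
  have 1: "A * B = A * C"
  proof -
    have "A * B = A * C * A * B" using C(1) by simp
    also have "\<dots> = mat_adjoint (A * C) * mat_adjoint (A * B)"
      using B(3) C(3) by (simp add: mat_mult_assoc_dims)
    also have "\<dots> = mat_adjoint (A * B * (A * C))" by (simp add: mat_adjoint_mult)
    also have "A * B * (A * C) = A * B * A * C" by (simp add: mat_mult_assoc_dims)
    finally show ?thesis using B(1) C(3) by simp
  qed
  have 2: "B * A = C * A"
  proof -
    have "B * A = B * (A * C * A)" using C(1) by simp
    also have "\<dots> = mat_adjoint (B * A) * mat_adjoint (C * A)"
      using B(4) C(4) by (simp add: mat_mult_assoc_dims)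
    also have "\<dots> = mat_adjoint (C * A * (B * A))" by (simp add: mat_adjoint_mult)
    also have "C * A * (B * A) = C * (A * B * A)" by (simp add: mat_mult_assoc_dims)
    finally show ?thesis using B(1) C(4) by simp
  qed
  have "B = B * (A * B)" using B(2) by (simp add: mat_mult_assoc_dims)
  also have "\<dots> = B * A * C" unfolding 1 by (simp add: mat_mult_assoc_dims)
  also have "\<dots> = C" unfolding 2 by (rule C(2))
  finally show ?thesis .
qed

lemma pinv_eq: "is_pinv A B \<Longrightarrow> pinv A = B"
  unfolding pinv_def using is_pinv_unique by blast

section \<open>Ranges, orthonormal bases and rank factorizations\<close>

lemma mat_im_eq:
  assumes "A \<in> carrier_mat m n"
  shows "mat_im A = {A *\<^sub>v x | x. x \<in> carrier_vec n}"
proof -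
  interpret vec_space "TYPE(complex)" m .
  show ?thesis using assms unfolding mat_im_def by (auto simp: col_space_eq[OF assms])
qed

lemma mat_factor_through:
  fixes G X :: "complex mat"
  assumes G: "G \<in> carrier_mat m k" and X: "X \<in> carrier_mat m n"
    and sub: "\<And>j. j < n \<Longrightarrow> col X j \<in> mat_im G"
  obtains S where "S \<in> carrier_mat k n" "X = G * S"
proof -
  have "\<forall>j\<in>{..<n}. \<exists>x. x \<in> carrier_vec k \<and> col X j = G *\<^sub>v x"
    using sub unfolding mat_im_eq[OF G] by auto
  then obtain f where f: "\<And>j. j < n \<Longrightarrow> f j \<in> carrier_vec k \<and> col X j = G *\<^sub>v f j"
    by (metis lessThan_iff)
  define S where "S = mat_of_cols k (map f [0..<n])"
  have S: "S \<in> carrier_mat k n" by (auto simp: S_def)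
  have colS: "col S j = f j" if "j < n" for j
    using that f[OF that] by (auto simp: S_def col_mat_of_cols)
  have "X = G * S"
  proof (rule mat_col_eqI)
    fix j assume "j < dim_col (G * S)"
    then have "j < n" using S by simp
    then show "col X j = col (G * S) j"
      using f[of j] colS[of j] G S col_mult2[of G m k S n j] by simp
  qed (use G X S in auto)
  with S show thesis by (rule that)
qed

lemma mat_im_mult_subset:
  assumes "A \<in> carrier_mat m n" "B \<in> carrier_mat n k"
  shows "mat_im (A * B) \<subseteq> mat_im A"
proof -
  have "A * B \<in> carrier_mat m k" using assms by simp
  from mat_im_eq[OF this] mat_im_eq[OF assms(1)] assms show ?thesis
    by (force simp: assoc_mult_mat_vec[OF assms])
qed

lemma mat_adjoint_mult_orthonormal:
  fixes us :: "complex vec list"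
  assumes "\<And>i j. i < k \<Longrightarrow> j < k \<Longrightarrow> us ! j \<bullet>c us ! i = (if i = j then 1 else 0)"
    and "length us = k" "set us \<subseteq> carrier_vec m"
  shows "mat_adjoint (mat_of_cols m us) * mat_of_cols m us = 1\<^sub>m k"
proof (rule eq_matI)
  fix i j assume "i < dim_row (1\<^sub>m k :: complex mat)" "j < dim_col (1\<^sub>m k :: complex mat)"
  then have ij: "i < k" "j < k" by auto
  have c: "us ! i \<in> carrier_vec m" "us ! j \<in> carrier_vec m" using assms ij by auto
  have "row (mat_adjoint (mat_of_cols m us)) i = conjugate (us ! i)"
    by (rule eq_vecI) (use ij assms(2) c in \<open>auto simp: mat_adjoint_index mat_of_cols_index\<close>)
  then show "(mat_adjoint (mat_of_cols m us) * mat_of_cols m us) $$ (i, j) = 1\<^sub>m k $$ (i, j)"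
    using ij assms c comm_scalar_prod[of "conjugate (us ! i)" m "us ! j"]
    by (simp add: col_mat_of_cols)
qed (use assms in auto)

text \<open>Gram-Schmidt is applied to a maximal independent set of columns: by maximality it spans
  the range, and its cardinality is the rank, which fixes the number of columns of
  \<open>U\<close>.\<close>

lemma orthonormal_basis_mat_im:
  fixes Z :: "complex mat"
  assumes Z: "Z \<in> carrier_mat m n"
  obtains U where "U \<in> carrier_mat m (vec_space.rank m Z)" "mat_adjoint U * U = 1\<^sub>m (vec_space.rank m Z)"
    "mat_im U = mat_im Z"
proof -
  interpret cof_vec_space m "TYPE(complex)" .
  let ?S = "set (cols Z)"
  have S: "?S \<subseteq> carrier_vec m" using Z cols_dim by blast
  have "lin_indpt ({} :: complex vec set)"
    by (metis empty_subsetI fin_dim finite_basis_exists subset_li_is_li vec_vs vectorspace.basis_def)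
  then obtain T where T: "finite T" "maximal T (\<lambda>T. T \<subseteq> ?S \<and> lin_indpt T)"
    using maximal_exists_superset[of ?S "\<lambda>T. T \<subseteq> ?S \<and> lin_indpt T" "{}"] by auto
  then have TS: "T \<subseteq> ?S" "lin_indpt T" by (auto simp: maximal_def)
  have rank: "rank Z = card T" by (rule rank_card_indpt[OF Z T(2)])
  have spanT: "span T = span ?S"
  proof
    show "span T \<subseteq> span ?S" using TS(1) by (rule span_is_monotone)
    have "?S \<subseteq> span T"
    proof
      fix s assume s: "s \<in> ?S"
      show "s \<in> span T"
      proof (rule ccontr)
        assume ns: "s \<notin> span T"
        have "lin_indpt (T \<union> {s})"
          using lindep_span TS S s ns by (meson lin_dep_iff_in_span rev_subsetD span_mem subset_trans)
        moreover have "s \<notin> T" using ns TS S by (meson span_mem subset_trans)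
        ultimately show False using T(2) TS s unfolding maximal_def
          by (metis Un_insert_right Un_upper1 insert_subset sup_bot_right)
      qed
    qed
    then show "span ?S \<subseteq> span T"
      using TS S by (meson span_is_submodule span_is_subset subset_trans)
  qed
  obtain ws where ws: "set ws = T" "distinct ws" using T(1) finite_distinct_list by blast
  define us where "us = gram_schmidt m ws"
  have wsc: "set ws \<subseteq> carrier_vec m" using ws TS S by auto
  note gs = gram_schmidt_result[OF wsc ws(2) _ us_def, unfolded ws(1)]
  have us: "span T = span (set us)" "corthogonal us" "set us \<subseteq> carrier_vec m" "length us = length ws"
    using gs TS by auto
  have len: "length us = rank Z" using rank us(4) ws distinct_card by force
  \<comment> \<open>Gram-Schmidt leaves the vectors orthogonal and non-zero but not normalized. The
    inner product of a vector with itself is a non-negative real in complex type, hence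
    \<open>Re\<close> under the root.\<close>
  define c where "c u = complex_of_real (1 / sqrt (Re (u \<bullet>c u)))" for u :: "complex vec"
  define vs where "vs = map (\<lambda>u. c u \<cdot>\<^sub>v u) us"
  have vsc: "set vs \<subseteq> carrier_vec m" using us by (auto simp: vs_def)
  have ip: "vs ! j \<bullet>c vs ! i = (if i = j then 1 else 0)" if ij: "i < rank Z" "j < rank Z" for i j
  proof -
    have cc: "us ! i \<in> carrier_vec m" "us ! j \<in> carrier_vec m" using us ij len by auto
    have eq: "vs ! j \<bullet>c vs ! i = c (us ! j) * c (us ! i) * (us ! j \<bullet>c us ! i)"
      using cc ij len by (simp add: vs_def conjugate_smult_vec c_def)
    show ?thesis
    proof (cases "i = j")
      case False
      then show ?thesis using eq corthogonalD[OF us(2), of j i] ij len by simp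
    next
      case True
      define z where "z = us ! i \<bullet>c us ! i"
      have "z \<noteq> 0" using corthogonalD[OF us(2), of i i] ij len by (simp add: z_def)
      moreover have "z \<ge> 0" using cc by (simp add: z_def conjugate_square_ge_0_vec)
      ultimately have "Re z > 0" "z = complex_of_real (Re z)"
        by (auto simp: less_eq_complex_def complex_eq_iff)
      then have "c (us ! i) * c (us ! i) * z = 1"
        by (simp add: c_def z_def[symmetric] complex_eq_iff power2_eq_square[symmetric] field_simps)
      then show ?thesis using eq True by (simp add: z_def)
    qed
  qed
  define U where "U = mat_of_cols m vs"
  have lenv: "length vs = rank Z" by (simp add: vs_def len)
  have U: "U \<in> carrier_mat m (rank Z)" by (simp add: U_def lenv[symmetric])
  have c0: "c (us ! i) \<noteq> 0" if "i < rank Z" for i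
  proof
    assume "c (us ! i) = 0"
    then have "vs ! i = 0 \<cdot>\<^sub>v us ! i" using that len by (simp add: vs_def)
    then have "vs ! i \<bullet>c vs ! i = 0" by simp
    then show False using ip[OF that that] by simp
  qed
  have "span (set vs) = span (set us)"
  proof
    have "set vs \<subseteq> span (set us)"
    proof
      fix v assume "v \<in> set vs"
      then obtain u where "u \<in> set us" "v = c u \<cdot>\<^sub>v u" by (auto simp: vs_def)
      then show "v \<in> span (set us)" using us(3) by (metis smult_in_span span_mem)
    qed
    then show "span (set vs) \<subseteq> span (set us)" using us(3) by (rule span_subsetI[rotated])
    have "set us \<subseteq> span (set vs)"
    proof
      fix u assume "u \<in> set us"
      then obtain i where i: "i < rank Z" "u = us ! i" by (metis in_set_conv_nth len)
      then have "u = (1 / c u) \<cdot>\<^sub>v (c u \<cdot>\<^sub>v u)" using c0 by (simp add: smult_smult_assoc)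
      moreover have "c u \<cdot>\<^sub>v u \<in> set vs" using i len by (simp add: vs_def)
      ultimately show "u \<in> span (set vs)" using vsc by (metis smult_in_span span_mem)
    qed
    then show "span (set us) \<subseteq> span (set vs)" using vsc by (rule span_subsetI[rotated])
  qed
  then have "mat_im U = mat_im Z"
    using us(1) spanT vsc U Z by (simp add: mat_im_def col_space_def U_def)
  with U mat_adjoint_mult_orthonormal[OF ip lenv vsc] show thesis
    using that by (simp add: U_def)
qed


lemma col_in_mat_im:
  assumes Z: "Z \<in> carrier_mat m n" and "j < n"
  shows "col Z j \<in> mat_im Z"
proof -
  have "col Z j = Z *\<^sub>v unit_vec n j"
    by (rule eq_vecI) (use assms in simp_all)
  then show ?thesis unfolding mat_im_eq[OF Z] by auto
qed

text \<open>\<open>L\<close> holds the coordinates of the columns of \<open>Z\<close> in an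
  orthonormal basis \<open>U\<close> of the range, and \<open>R\<close> writes that basis in terms
  of the columns of \<open>Z\<close>. Then U L R = Z R = U, and cancelling U gives L R = 1. The
  one-sided inverses of \<open>U\<close> and \<open>L\<close> express full rank in a form that
  allows cancellation in matrix equations.\<close>

lemma rank_factorization:
  fixes Z :: "complex mat"
  assumes Z: "Z \<in> carrier_mat m n"
  obtains U L R where "U \<in> carrier_mat m (vec_space.rank m Z)" "L \<in> carrier_mat (vec_space.rank m Z) n"
    "R \<in> carrier_mat n (vec_space.rank m Z)"
    "mat_adjoint U * U = 1\<^sub>m (vec_space.rank m Z)" "L * R = 1\<^sub>m (vec_space.rank m Z)"
    "Z = U * L" "U = Z * R"
proof -
  define k where "k = vec_space.rank m Z"
  obtain U where U: "U \<in> carrier_mat m k" "mat_adjoint U * U = 1\<^sub>m k" "mat_im U = mat_im Z"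
    using orthonormal_basis_mat_im[OF Z] unfolding k_def by blast
  obtain L where L: "L \<in> carrier_mat k n" "Z = U * L"
    using mat_factor_through[OF U(1) Z] col_in_mat_im[OF Z] U(3) by blast
  obtain R where R: "R \<in> carrier_mat n k" "U = Z * R"
    using mat_factor_through[OF Z U(1)] col_in_mat_im[OF U(1)] U(3) by blast
  note [simp] = carrier_matD[OF Z] carrier_matD[OF U(1)] carrier_matD[OF L(1)] carrier_matD[OF R(1)]
  have "L * R = (mat_adjoint U * U) * L * R" unfolding U(2) by simp
  also have "\<dots> = mat_adjoint U * ((U * L) * R)" by (simp add: mat_mult_assoc_dims)
  also have "\<dots> = 1\<^sub>m k" unfolding L(2)[symmetric] R(2)[symmetric] by (rule U(2))
  finally show thesis using that U L R unfolding k_def by blast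
qed

text \<open>Factoring A = U L and then the adjoint of L gives A = U N V* with orthonormal columns in
  U and V and with N invertible. The pseudo-inverse is V N^-1 U*, and its products with A are the
  orthogonal projections U U* and V V*.\<close>

lemma is_pinv_exists: "\<exists>B. is_pinv A B"
proof -
  define m n where "m = dim_row A" and "n = dim_col A"
  have A: "A \<in> carrier_mat m n" by (rule carrier_matI; simp add: m_def n_def)
  define k where "k = vec_space.rank m A"
  obtain U L R where U: "U \<in> carrier_mat m k" "L \<in> carrier_mat k n" "R \<in> carrier_mat n k"
    "mat_adjoint U * U = 1\<^sub>m k" "L * R = 1\<^sub>m k" "A = U * L" "U = A * R"
    by (rule rank_factorization[OF A, folded k_def])
  define l where "l = vec_space.rank n (mat_adjoint L)"
  obtain V K Q where V: "V \<in> carrier_mat n l" "K \<in> carrier_mat l k" "Q \<in> carrier_mat k l"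
    "mat_adjoint V * V = 1\<^sub>m l" "K * Q = 1\<^sub>m l" "mat_adjoint L = V * K" "V = mat_adjoint L * Q"
    by (rule rank_factorization[OF mat_adjoint_carrier[OF U(2)], folded l_def])
  note [simp] = carrier_matD[OF U(1)] carrier_matD[OF U(2)] carrier_matD[OF U(3)]
    carrier_matD[OF V(1)] carrier_matD[OF V(2)] carrier_matD[OF V(3)]
  define N T where "N = mat_adjoint K" and "T = mat_adjoint Q"
  have [simp]: "dim_row N = k" "dim_col N = l" "dim_row T = l" "dim_col T = k"
    by (simp_all add: N_def T_def)
  have L: "L = N * mat_adjoint V"
    using arg_cong[OF V(6), of mat_adjoint] by (simp add: mat_adjoint_mult N_def)
  have TN: "T * N = 1\<^sub>m l"
    using arg_cong[OF V(5), of mat_adjoint] by (simp add: mat_adjoint_mult N_def T_def)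
  \<comment> \<open>\<open>N\<close> has the left inverse \<open>T\<close> and the right inverse V*
    R. The two must coincide, so \<open>T\<close> inverts \<open>N\<close> on both sides although
    \<open>k = l\<close> has not been established.\<close>
  have NVR: "N * (mat_adjoint V * R) = 1\<^sub>m k" using U(5) unfolding L by (simp add: mat_mult_assoc_dims)
  have "T = T * (N * (mat_adjoint V * R))" unfolding NVR by simp
  also have "\<dots> = (T * N) * (mat_adjoint V * R)" by (simp add: mat_mult_assoc_dims)
  finally have NT: "N * T = 1\<^sub>m k" using NVR unfolding TN by simp
  note cancel = left_inverse_mult_cancel[OF U(4)] left_inverse_mult_cancel[OF V(4)]
    left_inverse_mult_cancel[OF NT] left_inverse_mult_cancel[OF TN]
  define B where "B = V * (T * mat_adjoint U)"
  have Aeq: "A = U * (N * mat_adjoint V)" using U(6) L by simp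
  have AB: "A * B = U * mat_adjoint U" unfolding Aeq B_def by (simp add: mat_mult_assoc_dims cancel)
  have BA: "B * A = V * mat_adjoint V" unfolding Aeq B_def by (simp add: mat_mult_assoc_dims cancel)
  have "A * B * A = A" unfolding AB unfolding Aeq by (simp add: mat_mult_assoc_dims cancel)
  moreover have "B * A * B = B" unfolding BA unfolding B_def by (simp add: mat_mult_assoc_dims cancel)
  moreover have "B \<in> carrier_mat (dim_col A) (dim_row A)"
    by (rule carrier_matI; simp add: B_def m_def[symmetric] n_def[symmetric])
  ultimately have "is_pinv A B"
    unfolding is_pinv_def AB BA by (simp add: mat_adjoint_mult)
  then show ?thesis ..
qed

lemma is_pinv_pinv: "is_pinv A (pinv A)"
  using is_pinv_exists[of A] pinv_eq by blast

text \<open>The orthonormal basis of the smaller range is V = U T with T* T = 1, so T cannot have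
  more columns than rows. If the ranks agree, T is square, hence T T* = 1, and A = U T T* L = V T*
  L, where V factors through A B.\<close>

lemma rank_mult_le_and_eqD:
  fixes A B :: "complex mat"
  assumes A: "A \<in> carrier_mat m n" and B: "B \<in> carrier_mat n n'"
  shows "vec_space.rank m (A * B) \<le> vec_space.rank m A"
    and "vec_space.rank m (A * B) = vec_space.rank m A \<Longrightarrow> \<exists>W \<in> carrier_mat n' n. A = A * B * W"
proof -
  define k l where "k = vec_space.rank m A" and "l = vec_space.rank m (A * B)"
  have AB: "A * B \<in> carrier_mat m n'" using A B by simp
  obtain U L R where U: "U \<in> carrier_mat m k" "L \<in> carrier_mat k n" "R \<in> carrier_mat n k"
    "mat_adjoint U * U = 1\<^sub>m k" "L * R = 1\<^sub>m k" "A = U * L" "U = A * R"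
    by (rule rank_factorization[OF A, folded k_def])
  obtain V K Q where V: "V \<in> carrier_mat m l" "K \<in> carrier_mat l n'" "Q \<in> carrier_mat n' l"
    "mat_adjoint V * V = 1\<^sub>m l" "K * Q = 1\<^sub>m l" "A * B = V * K" "V = A * B * Q"
    by (rule rank_factorization[OF AB, folded l_def])
  note [simp] = carrier_matD[OF A] carrier_matD[OF B] carrier_matD[OF U(1)] carrier_matD[OF U(2)]
    carrier_matD[OF U(3)] carrier_matD[OF V(1)] carrier_matD[OF V(2)] carrier_matD[OF V(3)]
  define T where "T = L * B * Q"
  have T: "T \<in> carrier_mat k l" by (rule carrier_matI; simp add: T_def)
  note [simp] = carrier_matD[OF T]
  have VT: "V = U * T" unfolding V(7) T_def U(6) by (simp add: mat_mult_assoc_dims)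
  have "mat_adjoint V * V = mat_adjoint T * (mat_adjoint U * U) * T"
    unfolding VT by (simp add: mat_adjoint_mult mat_mult_assoc_dims)
  then have TT: "mat_adjoint T * T = 1\<^sub>m l"
    unfolding V(4) U(4) by simp
  show "vec_space.rank m (A * B) \<le> vec_space.rank m A"
    using one_sided_inverse_dims_le[OF mat_adjoint_carrier[OF T] T TT] by (simp add: k_def l_def)
  assume "vec_space.rank m (A * B) = vec_space.rank m A"
  then have "l = k" by (simp add: k_def l_def)
  then have TT': "T * mat_adjoint T = 1\<^sub>m k"
    using mat_mult_left_right_inverse[OF _ _ TT] T by simp
  have "A = U * (T * mat_adjoint T) * L" unfolding TT' using U(6) by simp
  also have "\<dots> = (U * T) * (mat_adjoint T * L)" by (simp add: mat_mult_assoc_dims)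
  also have "\<dots> = A * B * (Q * mat_adjoint T * L)"
    unfolding VT[symmetric] V(7) by (simp add: mat_mult_assoc_dims)
  finally have "A = A * B * (Q * mat_adjoint T * L)" .
  moreover have "Q * mat_adjoint T * L \<in> carrier_mat n' n" by (rule carrier_matI; simp)
  ultimately show "\<exists>W \<in> carrier_mat n' n. A = A * B * W" by blast
qed

text \<open>A \<open>LEAST\<close> value carries information only if some exponent qualifies, so
  stabilization of the ranks comes first: strict descent from exponent 1 on would give r (k + 1) + k
  <= r 1 for every k. Index 1 then means that M^2 and M have the same rank.\<close>

lemma mat_index_one_factor:
  assumes M: "M \<in> carrier_mat n n" and ind: "mat_index M = 1"
  obtains W where "W \<in> carrier_mat n n" "M = M * M * W"
proof -
  define r where "r k = vec_space.rank n (M ^\<^sub>m k)" for k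
  have r: "r (Suc k) \<le> r k" for k
    using rank_mult_le_and_eqD(1)[of "M ^\<^sub>m k" n n M n] M by (simp add: r_def)
  have "\<exists>k\<ge>1. r (k + 1) = r k"
  proof (rule ccontr)
    assume "\<not> ?thesis"
    then have less: "r (Suc k) < r k" if "k \<ge> 1" for k using r[of k] that by force
    have "r (Suc k) + k \<le> r 1" for k
    proof (induction k)
      case (Suc k)
      then show ?case using less[of "Suc k"] by simp
    qed simp
    from this[of "Suc (r 1)"] show False by simp
  qed
  then have "r (mat_index M + 1) = r (mat_index M)"
    unfolding mat_index_def r_def carrier_matD(1)[OF M] by (rule LeastI2_ex) blast
  then have "vec_space.rank n (M * M) = vec_space.rank n M"
    unfolding ind r_def using M by (simp add: numeral_2_eq_2)
  then show thesis using rank_mult_le_and_eqD(2)[OF M M] that by blast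
qed

section \<open>Kernels, orthogonal complements and range-Hermitian matrices\<close>

lemma mat_mult_eq_0_iff_cols_kernel:
  assumes M: "M \<in> carrier_mat m n" and X: "X \<in> carrier_mat n k"
  shows "M * X = 0\<^sub>m m k \<longleftrightarrow> (\<forall>j<k. col X j \<in> mat_kernel M)"
proof
  assume 0: "M * X = 0\<^sub>m m k"
  show "\<forall>j<k. col X j \<in> mat_kernel M"
  proof (intro allI impI)
    fix j assume j: "j < k"
    then have "M *\<^sub>v col X j = col (0\<^sub>m m k) j" using col_mult2[OF M X j] 0 by simp
    then show "col X j \<in> mat_kernel M" using X j by (intro mat_kernelI[OF M]) auto
  qed
next
  assume ker: "\<forall>j<k. col X j \<in> mat_kernel M"
  show "M * X = 0\<^sub>m m k"
    by (rule mat_col_eqI) (use ker mat_kernelD(2)[OF M] col_mult2[OF M X] M X in auto)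
qed

lemma orth_compl_mat_im:
  assumes M: "M \<in> carrier_mat m n"
  shows "orth_compl m (mat_im M) = mat_kernel (mat_adjoint M)"
proof
  note M' = mat_adjoint_carrier[OF M]
  show "orth_compl m (mat_im M) \<subseteq> mat_kernel (mat_adjoint M)"
  proof
    fix v assume v: "v \<in> orth_compl m (mat_im M)"
    \<comment> \<open>Testing \<open>v\<close> against M w for this particular \<open>w\<close>
      gives the squared norm of \<open>w\<close>, which is therefore 0.\<close>
    define w where "w = mat_adjoint M *\<^sub>v v"
    have vc: "v \<in> carrier_vec m" using v by (simp add: orth_compl_def)
    have w: "w \<in> carrier_vec n" unfolding w_def using M' vc by simp
    have "w \<bullet>c w = v \<bullet>c (M *\<^sub>v w)"
      unfolding w_def by (rule mat_adjoint_scalar_prod) (use M vc in auto)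
    also have "\<dots> = 0" using v w unfolding orth_compl_def mat_im_eq[OF M] by blast
    finally have "w = 0\<^sub>v n" using conjugate_square_eq_0_vec[OF w] by simp
    then show "v \<in> mat_kernel (mat_adjoint M)" using vc by (intro mat_kernelI[OF M']) (auto simp: w_def)
  qed
  show "mat_kernel (mat_adjoint M) \<subseteq> orth_compl m (mat_im M)"
  proof
    fix v assume v: "v \<in> mat_kernel (mat_adjoint M)"
    note v' = mat_kernelD[OF M' v]
    have "v \<bullet>c (M *\<^sub>v x) = 0" if x: "x \<in> carrier_vec n" for x
      using mat_adjoint_scalar_prod[of v M x] M v' x by simp
    then show "v \<in> orth_compl m (mat_im M)" using v' unfolding orth_compl_def mat_im_eq[OF M] by auto
  qed
qed

lemma mat_im_eq_kernelD:
  assumes X: "X \<in> carrier_mat n k" and M: "M \<in> carrier_mat m n" and eq: "mat_im X = mat_kernel M"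
  shows "M * X = 0\<^sub>m m k"
    and "\<lbrakk>Z \<in> carrier_mat n l; M * Z = 0\<^sub>m m l\<rbrakk> \<Longrightarrow> \<exists>W \<in> carrier_mat k l. Z = X * W"
proof -
  show "M * X = 0\<^sub>m m k"
    unfolding mat_mult_eq_0_iff_cols_kernel[OF M X] eq[symmetric] using col_in_mat_im[OF X] by blast
  assume Z: "Z \<in> carrier_mat n l" "M * Z = 0\<^sub>m m l"
  then show "\<exists>W \<in> carrier_mat k l. Z = X * W"
    using mat_factor_through[OF X Z(1)] mat_mult_eq_0_iff_cols_kernel[OF M Z(1)] eq by blast
qed

text \<open>A = U L compresses A on the left only. The columns of A* also lie in im U, so A = Z* U*,
  and L = U* A therefore ends in U* too. The equation L R = 1 now reads C (U* R) = 1, so U* R is the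
  inverse of the square matrix \<open>C\<close>.\<close>

lemma EP_mat_decomp:
  assumes A: "A \<in> carrier_mat n n" and EP: "EP_mat A"
  obtains k U C B where "U \<in> carrier_mat n k" "C \<in> carrier_mat k k" "B \<in> carrier_mat k k"
    "mat_adjoint U * U = 1\<^sub>m k" "C * B = 1\<^sub>m k" "B * C = 1\<^sub>m k"
    "A = U * C * mat_adjoint U" "pinv A = U * B * mat_adjoint U"
proof -
  define k where "k = vec_space.rank n A"
  obtain U L R where U: "U \<in> carrier_mat n k" "L \<in> carrier_mat k n" "R \<in> carrier_mat n k"
    "mat_adjoint U * U = 1\<^sub>m k" "L * R = 1\<^sub>m k" "A = U * L" "U = A * R"
    by (rule rank_factorization[OF A, folded k_def])
  have A': "mat_adjoint A \<in> carrier_mat n n" using A by simp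
  have "mat_im (mat_adjoint A) \<subseteq> mat_im U"
    using EP mat_im_mult_subset[OF U(1,2)] U(6) by (simp add: EP_mat_def)
  then obtain Z where Z: "Z \<in> carrier_mat k n" "mat_adjoint A = U * Z"
    using mat_factor_through[OF U(1) A'] col_in_mat_im[OF A'] by blast
  note [simp] = carrier_matD[OF A] carrier_matD[OF U(1)] carrier_matD[OF U(2)] carrier_matD[OF U(3)]
    carrier_matD[OF Z(1)]
  note cancelU = left_inverse_mult_cancel[OF U(4)]
  define C where "C = mat_adjoint U * mat_adjoint Z"
  define B where "B = mat_adjoint U * R"
  have C: "C \<in> carrier_mat k k" and B: "B \<in> carrier_mat k k"
    by (rule carrier_matI; simp add: C_def B_def)+
  note [simp] = carrier_matD[OF C] carrier_matD[OF B]
  have AZ: "A = mat_adjoint Z * mat_adjoint U"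
    using arg_cong[OF Z(2), of mat_adjoint] by (simp add: mat_adjoint_mult)
  have "L = mat_adjoint U * A" unfolding U(6) by (simp add: cancelU)
  also have "\<dots> = C * mat_adjoint U" unfolding AZ C_def by (simp add: mat_mult_assoc_dims)
  finally have L: "L = C * mat_adjoint U" .
  have CB: "C * B = 1\<^sub>m k" using U(5) unfolding L B_def by (simp add: mat_mult_assoc_dims)
  have BC: "B * C = 1\<^sub>m k" by (rule mat_mult_left_right_inverse[OF C B CB])
  note cancel = cancelU left_inverse_mult_cancel[OF CB] left_inverse_mult_cancel[OF BC]
  have AC: "A = U * C * mat_adjoint U" unfolding U(6) L by (simp add: mat_mult_assoc_dims)
  have "is_pinv A (U * B * mat_adjoint U)"
  proof -
    have 1: "A * (U * B * mat_adjoint U) = U * mat_adjoint U"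
      unfolding AC by (simp add: mat_mult_assoc_dims cancel)
    have 2: "U * B * mat_adjoint U * A = U * mat_adjoint U"
      unfolding AC by (simp add: mat_mult_assoc_dims cancel)
    have "A * (U * B * mat_adjoint U) * A = A"
      unfolding 1 unfolding AC by (simp add: mat_mult_assoc_dims cancel)
    moreover have "U * B * mat_adjoint U * A * (U * B * mat_adjoint U) = U * B * mat_adjoint U"
      unfolding 2 by (simp add: mat_mult_assoc_dims cancel)
    moreover have "U * B * mat_adjoint U \<in> carrier_mat (dim_col A) (dim_row A)"
      by (rule carrier_matI; simp)
    ultimately show ?thesis unfolding is_pinv_def 1 2 by (simp add: mat_adjoint_mult)
  qed
  then have "pinv A = U * B * mat_adjoint U" by (rule pinv_eq)
  with U C B CB BC AC show thesis using that by blast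
qed

subsection \<open>The pseudo-determinant formula\<close>

theorem mainTheorem5:
  fixes A X Y M P Xhat Yhat :: "complex mat" and n p q r s :: nat
  assumes A: "A \<in> carrier_mat n n"
    and X: "X \<in> carrier_mat n p"
    and Y: "Y \<in> carrier_mat n q"
    and EP: "EP_mat A"
    and M: "M = pinv A - pinv A * X * pinv (mat_adjoint Y * pinv A * X) * mat_adjoint Y * pinv A"
    and Xhat: "Xhat \<in> carrier_mat n r"
    and Yhat: "Yhat \<in> carrier_mat n s"
    and im_Xhat: "mat_im Xhat = mat_kernel M"
    and im_Yhat: "mat_im Yhat = orth_compl n (mat_im M)"
    and ind: "mat_index M = 1"
    and same_cols: "r = s"
    and P: "P = A * pinv A"
    and ker: "mat_kernel (P * Xhat) \<inter> orth_compl s (mat_kernel (P * Yhat)) = {0\<^sub>v r}"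
  shows "pseudo_det M =
    pseudo_det (mat_adjoint Yhat * P * Xhat) /
      (pseudo_det A * pseudo_det (mat_adjoint Yhat * pinv A * Xhat))"
proof -
  obtain a U C B where U: "U \<in> carrier_mat n a" "C \<in> carrier_mat a a" "B \<in> carrier_mat a a"
    "mat_adjoint U * U = 1\<^sub>m a" "C * B = 1\<^sub>m a" "B * C = 1\<^sub>m a"
    "A = U * C * mat_adjoint U" "pinv A = U * B * mat_adjoint U"
    by (rule EP_mat_decomp[OF A EP])
  have Yhat': "Yhat \<in> carrier_mat n r" using Yhat same_cols by simp
  note [simp] = carrier_matD[OF A] carrier_matD[OF X] carrier_matD[OF Y] carrier_matD[OF U(1)]
    carrier_matD[OF U(2)] carrier_matD[OF U(3)] carrier_matD[OF Xhat] carrier_matD[OF Yhat']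
  define D where "D = pinv (mat_adjoint Y * pinv A * X)"
  have "D \<in> carrier_mat p q" and D: "D * (mat_adjoint Y * pinv A * X) * D = D"
    using is_pinv_pinv[of "mat_adjoint Y * pinv A * X"] by (auto simp: is_pinv_def D_def)
  note [simp] = carrier_matD[OF this(1)]
  \<comment> \<open>The correction term of \<open>M\<close> is U B Q B U*. The Penrose equation for
    \<open>D\<close>, with \<open>D\<close> on the outside, becomes Q B Q = Q.\<close>
  define Q where "Q = mat_adjoint U * X * D * mat_adjoint Y * U"
  have Q: "Q \<in> carrier_mat a a" by (rule carrier_matI; simp add: Q_def)
  have QBQ: "Q * B * Q = Q"
  proof -
    have "Q * B * Q = mat_adjoint U * X * (D * (mat_adjoint Y * pinv A * X) * D) * mat_adjoint Y * U"
      unfolding U(8) Q_def by (simp add: mat_mult_assoc_dims)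
    then show ?thesis unfolding D Q_def .
  qed
  define k where "k = vec_space.rank a Q"
  obtain G L R where G: "G \<in> carrier_mat a k" "L \<in> carrier_mat k a" "R \<in> carrier_mat a k"
    "mat_adjoint G * G = 1\<^sub>m k" "L * R = 1\<^sub>m k" "Q = G * L" "G = Q * R"
    by (rule rank_factorization[OF Q, folded k_def])
  note [simp] = carrier_matD[OF Q] carrier_matD[OF G(1)] carrier_matD[OF G(2)] carrier_matD[OF G(3)]
  \<comment> \<open>Q B Q = Q reads G (L B G) L = G L; \<open>G\<close> is cancelled on the left by
    its adjoint and \<open>L\<close> on the right by \<open>R\<close>.\<close>
  have LBG: "L * (B * G) = 1\<^sub>m k"
  proof -
    have "L * (B * G) = (mat_adjoint G * G) * (L * (B * (G * (L * R))))"
      unfolding G(4,5) by simp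
    also have "\<dots> = mat_adjoint G * (Q * B * Q) * R"
      unfolding G(6) by (simp add: mat_mult_assoc_dims)
    also have "\<dots> = (mat_adjoint G * G) * (L * R)"
      unfolding QBQ unfolding G(6) by (simp add: mat_mult_assoc_dims)
    finally show ?thesis unfolding G(4,5) by simp
  qed
  have BGL_cancel: "L * (B * (G * Z)) = Z" if "dim_row Z = k" for Z
    using left_inverse_mult_cancel[OF LBG, of Z] that by (simp add: mat_mult_assoc_dims)
  note cancel = left_inverse_mult_cancel[OF U(4)] left_inverse_mult_cancel[OF U(5)]
    left_inverse_mult_cancel[OF U(6)] left_inverse_mult_cancel[OF G(5)] BGL_cancel

  \<comment> \<open>C N = 1 - G L B and N C = 1 - B G L, where G L B and B G L are idempotent
    because L B G = 1. This is why the kernel of \<open>N\<close> is im G and its range is ker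
    L.\<close>
  define N where "N = B - B * G * L * B"
  have N: "N \<in> carrier_mat a a" by (rule carrier_matI; simp add: N_def)
  note [simp] = carrier_matD[OF N]
  have MN: "M = U * (N * mat_adjoint U)"
  proof -
    have "M = U * B * mat_adjoint U - U * (B * (Q * (B * mat_adjoint U)))"
      unfolding M D_def[symmetric] unfolding U(8) Q_def by (simp add: mat_mult_assoc_dims)
    then show ?thesis unfolding G(6) N_def by (simp add: mat_mult_assoc_dims mat_dims_simps)
  qed
  have Mc: "M \<in> carrier_mat n n" by (rule carrier_matI; simp add: MN)
  note [simp] = carrier_matD[OF Mc]
  have LN: "L * N = 0\<^sub>m k a"
    unfolding N_def by (simp add: mat_mult_assoc_dims mat_dims_simps cancel mat_minus_self)
  have det_LG: "det (L * G) \<noteq> 0"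
  proof -
    obtain W where W: "W \<in> carrier_mat n n" "M = M * M * W" by (rule mat_index_one_factor[OF Mc ind])
    note [simp] = carrier_matD[OF W(1)]
    \<comment> \<open>Compressing \<open>W\<close> in the same way turns M = M M W into N = N N
      V.\<close>
    define V where "V = mat_adjoint U * W * U"
    have V: "dim_row V = a" "dim_col V = a" by (simp_all add: V_def)
    note [simp] = V
    have "N = mat_adjoint U * M * U" unfolding MN by (simp add: mat_mult_assoc_dims cancel U(4))
    also have "\<dots> = mat_adjoint U * (M * M * W) * U" using W(2) by simp
    also have "\<dots> = N * (N * V)" unfolding MN V_def by (simp add: mat_mult_assoc_dims cancel)
    finally have NNV: "N * (N * V) = N" by simp
    \<comment> \<open>N = N N V is multiplied by L C on the left and by R on the right. The left
      side becomes 1 minus a multiple of L G, by L R = 1; the right side becomes minus a multiple of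
      L G, by L N = 0. So L G has the right inverse \<open>K\<close>.\<close>
    have LCN: "L * (C * N) = L - L * (G * (L * B))"
      unfolding N_def by (simp add: mat_mult_assoc_dims mat_dims_simps cancel U(5))
    have "1\<^sub>m k - L * (G * (L * (B * R))) = L * (C * N) * R"
      unfolding LCN by (simp add: mat_mult_assoc_dims mat_dims_simps G(5))
    also have "\<dots> = L * (C * (N * (N * V) * R))" unfolding NNV by (simp add: mat_mult_assoc_dims)
    also have "\<dots> = L * (C * N) * (N * (V * R))" by (simp add: mat_mult_assoc_dims)
    also have "\<dots> = L * N * (V * R) - L * (G * (L * (B * (N * (V * R)))))"
      unfolding LCN by (simp add: mat_mult_assoc_dims mat_dims_simps)
    also have "L * N * (V * R) = 0\<^sub>m k k" unfolding LN by simp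
    finally have eq: "1\<^sub>m k - L * (G * (L * (B * R))) = 0\<^sub>m k k - L * (G * (L * (B * (N * (V * R)))))" .
    define K where "K = L * (B * R) - L * (B * (N * (V * R)))"
    have "L * G * K = 1\<^sub>m k"
      using mat_minus_eq_uminus_swap[OF eq] by (simp add: K_def mat_mult_assoc_dims mat_mult_minus_dims)
    moreover have "L * G \<in> carrier_mat k k" "K \<in> carrier_mat k k"
      by (rule carrier_matI; simp add: K_def)+
    ultimately have "det (L * G) * det K = 1" using det_mult[of "L * G" k K] by simp
    then show ?thesis by auto
  qed

  \<comment> \<open>The columns of U* Xhat lie in ker N = im G, onto which G L B projects; so U*
    Xhat = G (L B U* Xhat). \<open>T\<close> arises in the same way from N C = 1 - B G L and the
    rows of Yhat* U.\<close>
  define S where "S = L * (B * (mat_adjoint U * Xhat))"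
  have S: "S \<in> carrier_mat k r" by (rule carrier_matI; simp add: S_def)
  note [simp] = carrier_matD[OF S]
  have UX: "mat_adjoint U * Xhat = G * S"
  proof -
    have "0\<^sub>m a r = C * (mat_adjoint U * (M * Xhat))"
      using mat_im_eq_kernelD(1)[OF Xhat Mc im_Xhat] by simp
    also have "\<dots> = mat_adjoint U * Xhat - G * S"
      unfolding MN N_def S_def by (simp add: mat_mult_assoc_dims mat_dims_simps cancel)
    finally show ?thesis by (rule mat_eq_if_minus_eq_0) simp_all
  qed

  define T where "T = mat_adjoint Yhat * (U * (B * G))"
  have T: "T \<in> carrier_mat r k" by (rule carrier_matI; simp add: T_def)
  note [simp] = carrier_matD[OF T]
  have im_Yhat': "mat_im Yhat = mat_kernel (mat_adjoint M)"
    unfolding im_Yhat by (rule orth_compl_mat_im[OF Mc])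
  have M': "mat_adjoint M \<in> carrier_mat n n" using Mc by simp
  have YU: "mat_adjoint Yhat * U = T * L"
  proof -
    have "mat_adjoint M * Yhat = 0\<^sub>m n r" by (rule mat_im_eq_kernelD(1)[OF Yhat' M' im_Yhat'])
    from arg_cong[OF this, of mat_adjoint]
    have "mat_adjoint Yhat * M = 0\<^sub>m r n" by (simp add: mat_adjoint_mult mat_adjoint_zero)
    then have "0\<^sub>m r a = mat_adjoint Yhat * M * (U * C)" by simp
    also have "\<dots> = mat_adjoint Yhat * U - T * L"
      unfolding MN N_def T_def by (simp add: mat_mult_assoc_dims mat_dims_simps cancel U(6))
    finally show ?thesis by (rule mat_eq_if_minus_eq_0) simp_all
  qed
  \<comment> \<open>Since L N = 0, the columns of U L* lie in the kernel of M*, which is all of im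
    Yhat. Their coefficients \<open>V\<close> yield L = V* T L, and cancelling L by \<open>R\<close>
    makes V* a left inverse of \<open>T\<close>.\<close>
  obtain V where V: "V \<in> carrier_mat r k" "U * mat_adjoint L = Yhat * V"
  proof -
    have "L * mat_adjoint U * M = 0\<^sub>m k n"
      unfolding MN using arg_cong[OF LN, of "\<lambda>Z. Z * mat_adjoint U"]
      by (simp add: mat_mult_assoc_dims cancel)
    from arg_cong[OF this, of mat_adjoint]
    have "mat_adjoint M * (U * mat_adjoint L) = 0\<^sub>m n k"
      by (simp add: mat_adjoint_mult mat_adjoint_zero)
    moreover have "U * mat_adjoint L \<in> carrier_mat n k" by (rule carrier_matI; simp)
    ultimately show thesis using mat_im_eq_kernelD(2)[OF Yhat' M' im_Yhat'] that by blast
  qed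
  note [simp] = carrier_matD[OF V(1)]
  have VT: "mat_adjoint V * T = 1\<^sub>m k"
  proof -
    have "L = mat_adjoint V * (mat_adjoint Yhat * U)"
      using arg_cong[OF V(2), of "\<lambda>Z. mat_adjoint Z * U"]
      by (simp add: mat_adjoint_mult mat_mult_assoc_dims U(4))
    from arg_cong[OF this, of "\<lambda>Z. Z * R"] show ?thesis
      unfolding YU by (simp add: mat_mult_assoc_dims G(5))
  qed

  have PU: "P = U * mat_adjoint U"
    unfolding P U(8) unfolding U(7) by (simp add: mat_mult_assoc_dims cancel)
  have ST: "S * T \<in> carrier_mat k k" by (rule carrier_matI; simp)
  have det_ST: "det (S * T) \<noteq> 0"
  proof
    assume "det (S * T) = 0"
    then obtain v where v: "v \<in> carrier_vec k" "v \<noteq> 0\<^sub>v k" "S * T *\<^sub>v v = 0\<^sub>v k"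
      using det_0_iff_vec_prod_zero_field[OF ST] by blast
    \<comment> \<open>The vector T v is the one to which the kernel hypothesis applies: P Xhat T v =
      U G S T v = 0, and T v is orthogonal to ker (P Yhat). Once it vanishes, the left inverse V* of
      \<open>T\<close> gives v = 0.\<close>
    have Tv: "T *\<^sub>v v \<in> carrier_vec r" using T v by simp
    have PX: "P * Xhat \<in> carrier_mat n r" and PY: "P * Yhat \<in> carrier_mat n r"
      by (rule carrier_matI; simp add: PU)+
    have "P * Xhat *\<^sub>v (T *\<^sub>v v) = U * G *\<^sub>v (S * T *\<^sub>v v)"
    proof -
      have "P * Xhat * T = U * G * (S * T)"
        unfolding PU using UX by (simp add: mat_mult_assoc_dims)
      then show ?thesis
        using assoc_mult_mat_vec[OF PX T v(1)] assoc_mult_mat_vec[of "U * G" n k "S * T" k v] ST v(1) U(1) G(1)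
        by simp
    qed
    then have "T *\<^sub>v v \<in> mat_kernel (P * Xhat)"
      using v(3) U(1) G(1) by (intro mat_kernelI[OF PX Tv]) (simp add: PU)
    moreover have "T *\<^sub>v v \<in> orth_compl s (mat_kernel (P * Yhat))"
    proof -
      \<comment> \<open>Adjoints of Yhat* U = T L and L R = 1 give T* = R* U* Yhat, and U* P = U*
        allows \<open>P\<close> to be inserted. Hence T* vanishes on ker (P Yhat).\<close>
      have adjT: "mat_adjoint T = mat_adjoint R * (mat_adjoint U * (P * Yhat))"
      proof -
        have "mat_adjoint (T * L) = mat_adjoint U * Yhat"
          unfolding YU[symmetric] by (simp add: mat_adjoint_mult)
        then have "mat_adjoint R * (mat_adjoint L * mat_adjoint T) = mat_adjoint R * (mat_adjoint U * Yhat)"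
          by (simp add: mat_adjoint_mult)
        moreover have "mat_adjoint R * mat_adjoint L = 1\<^sub>m k"
          using arg_cong[OF G(5), of mat_adjoint] by (simp add: mat_adjoint_mult)
        ultimately show ?thesis
          unfolding PU by (simp add: mat_mult_assoc_dims cancel left_inverse_mult_cancel)
      qed
      have "(T *\<^sub>v v) \<bullet>c z = 0" if z: "z \<in> mat_kernel (P * Yhat)" for z
      proof -
        note z' = mat_kernelD[OF PY z]
        have RU: "mat_adjoint R * mat_adjoint U \<in> carrier_mat k n" by (rule carrier_matI; simp)
        have "mat_adjoint T = mat_adjoint R * mat_adjoint U * (P * Yhat)"
          unfolding adjT by (simp add: mat_mult_assoc_dims PU)
        then have "mat_adjoint T *\<^sub>v z = 0\<^sub>v k"
          using assoc_mult_mat_vec[OF RU PY z'(1)] z'(2) RU by simp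
        then show ?thesis
          using mat_adjoint_scalar_prod[of v "mat_adjoint T" z] v(1) z'(1) by simp
      qed
      then show ?thesis using Tv same_cols by (simp add: orth_compl_def)
    qed
    ultimately have "T *\<^sub>v v = 0\<^sub>v r" using ker by blast
    then have "mat_adjoint V *\<^sub>v (T *\<^sub>v v) = 0\<^sub>v k" using V(1) by simp
    moreover have "mat_adjoint V *\<^sub>v (T *\<^sub>v v) = v"
      using assoc_mult_mat_vec[OF mat_adjoint_carrier[OF V(1)] T v(1)] VT v(1) by simp
    ultimately show False using v(2) by simp
  qed

  have det_CB: "det C * det B = 1" using det_mult[OF U(2,3)] U(5) by simp
  then have "det B \<noteq> 0" "det C \<noteq> 0" by auto
  have "pseudo_det M = pseudo_det N"
  proof -
    have "pseudo_det M = pseudo_det (N * mat_adjoint U * U)"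
      unfolding MN by (rule pseudo_det_mult_swap[of _ n a]) (use U N in auto)
    then show ?thesis by (simp add: mat_mult_assoc_dims U(4))
  qed
  also have "\<dots> = det B * det (L * G)"
    unfolding N_def using LBG
    by (intro pseudo_det_oblique_complement[OF U(3) G(1,2) _ \<open>det B \<noteq> 0\<close> det_LG])
      (simp add: mat_mult_assoc_dims)
  finally have pM: "pseudo_det M = det B * det (L * G)" .
  have "pseudo_det A = pseudo_det (C * mat_adjoint U * U)"
    unfolding U(7) mat_mult_assoc_dims[of U C "mat_adjoint U", simplified]
    by (rule pseudo_det_mult_swap[of _ n a]) (use U in auto)
  then have "pseudo_det A = pseudo_det C"
    by (simp add: mat_mult_assoc_dims U(4))
  then have pA: "pseudo_det A = det C" using pseudo_det_eq_det[OF U(2) \<open>det C \<noteq> 0\<close>] by simp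
  have LG: "L * G \<in> carrier_mat k k" using G(1,2) by simp
  have "pseudo_det (mat_adjoint Yhat * P * Xhat) = pseudo_det (T * (L * G * S))"
  proof -
    have "mat_adjoint Yhat * P * Xhat = (mat_adjoint Yhat * U) * (mat_adjoint U * Xhat)"
      unfolding PU by (simp add: mat_mult_assoc_dims)
    then show ?thesis unfolding YU UX by (simp add: mat_mult_assoc_dims)
  qed
  \<comment> \<open>The \<open>r\<close> by \<open>r\<close> product becomes a \<open>k\<close> by
    \<open>k\<close> product of two invertible matrices, where the determinant is
    multiplicative.\<close>
  also have "\<dots> = pseudo_det (L * G * S * T)"
    by (rule pseudo_det_mult_swap[OF T]) (use LG S in auto)
  also have "L * G * S * T = (L * G) * (S * T)" by (simp add: mat_mult_assoc_dims)
  also have "pseudo_det \<dots> = det (L * G) * det (S * T)"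
    using pseudo_det_eq_det[of "(L * G) * (S * T)" k] det_mult[OF LG ST] det_LG det_ST LG ST by simp
  finally have pP: "pseudo_det (mat_adjoint Yhat * P * Xhat) = det (L * G) * det (S * T)" .
  have "pseudo_det (mat_adjoint Yhat * pinv A * Xhat) = pseudo_det (T * S)"
  proof -
    have "mat_adjoint Yhat * pinv A * Xhat = (mat_adjoint Yhat * U) * (B * (mat_adjoint U * Xhat))"
      unfolding U(8) by (simp add: mat_mult_assoc_dims)
    then show ?thesis unfolding YU UX by (simp add: mat_mult_assoc_dims cancel)
  qed
  also have "\<dots> = det (S * T)"
    using pseudo_det_mult_swap[OF T S] pseudo_det_eq_det[OF ST det_ST] by simp
  finally have pB: "pseudo_det (mat_adjoint Yhat * pinv A * Xhat) = det (S * T)" .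
  show ?thesis
    unfolding pM pA pP pB using det_CB det_ST \<open>det C \<noteq> 0\<close> by (simp add: field_simps)
qed

end
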